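(* There exist infinitely many permutation-invariant Niven numbers; in particular, their magnitude is unbounded.
   Context: All numbers are written in base 10. A Niven number is a positive integer divisible by the sum of its decimal digits. A permutation-invariant Niven number (PINN) is a positive integer for which every permutation of its decimal digits yields a Niven number, where leading zeros of the permuted digit string are omitted before reading it as an integer. *)

theory Defs
  imports Main "HOL-Library.Multiset"
begin

text \<open>Digit lists are little-endian: the units digit comes first.\<close>

fun decimal_digits :: "nat \<Rightarrow> nat list" where
  "decimal_digits n = (if n = 0 then [] else n mod 10 # decimal_digits (n div 10))"

declare decimal_digits.simps [simp del]

definition nat_of_digits :: "nat list \<Rightarrow> nat" where
  "nat_of_digits ds = horner_sum id 10 ds"

definition digit_sum :: "nat \<Rightarrow> nat" where
  "digit_sum n = sum_list (decimal_digits n)"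

definition niven :: "nat \<Rightarrow> bool" where
  "niven n \<longleftrightarrow> n > 0 \<and> digit_sum n dvd n"

text \<open>
  The lists \<open>ds\<close> with the same multiset of entries as \<open>decimal_digits n\<close> are exactly its
  rearrangements. A leading zero of the rearranged digit string is a final zero of \<open>ds\<close>; it does
  not affect \<open>nat_of_digits ds\<close>, and the digit sum in \<open>niven\<close> is that of the resulting integer.
\<close>

definition pinn :: "nat \<Rightarrow> bool" where
  "pinn n \<longleftrightarrow> n > 0 \<and>
     (\<forall>ds. mset ds = mset (decimal_digits n) \<longrightarrow> niven (nat_of_digits ds))"

lemma nat_of_digits_decimal_digits: "nat_of_digits (decimal_digits n) = n"
proof (induction n rule: decimal_digits.induct)
  case (1 n)
  then show ?case
    by (cases "n = 0") (simp_all add: nat_of_digits_def decimal_digits.simps [of n]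
        decimal_digits.simps [of 0])
qed

lemma decimal_digits_less_10: "d \<in> set (decimal_digits n) \<Longrightarrow> d < 10"
proof (induction n rule: decimal_digits.induct)
  case (1 n)
  then show ?case
    by (subst (asm) (2) decimal_digits.simps) (auto split: if_splits)
qed

end

theory Submission
  imports Defs
begin

text \<open>
  Powers of ten witness the theorem. Rearranging the digits of a number preserves their sum, even
  when zeros move to the front and are dropped (lemma \<open>digit_sum_nat_of_digits\<close>). So all
  rearrangements of a number of digit sum 1 have digit sum 1, which divides everything
  (lemma \<open>pinn_if_digit_sum_1\<close>), and \<open>10 ^ k\<close> is such a number for every \<open>k\<close>.
\<close>

lemma digit_sum_0 [simp]: "digit_sum 0 = 0"
  by (simp add: digit_sum_def decimal_digits.simps)

lemma digit_sum_rec: "digit_sum n = n mod 10 + digit_sum (n div 10)"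
  by (cases "n = 0") (simp_all add: digit_sum_def decimal_digits.simps [of n])

text \<open>
  A list ending in zeros is not the list of decimal digits of its value; the equation holds for
  it nevertheless, because the zeros lost do not contribute to the sum.
\<close>

lemma digit_sum_nat_of_digits:
  assumes "\<forall>d \<in> set ds. d < 10"
  shows "digit_sum (nat_of_digits ds) = sum_list ds"
  using assms
proof (induction ds)
  case Nil
  then show ?case by (simp add: nat_of_digits_def)
next
  case (Cons d ds)
  then show ?case
    by (subst digit_sum_rec) (simp add: nat_of_digits_def)
qed

lemma pinn_if_digit_sum_1:
  assumes "digit_sum n = 1"
  shows "pinn n"
  unfolding pinn_def
proof (intro conjI allI impI)
  show "n > 0"
    using assms by (cases "n = 0") simp_all
next
  fix ds
  assume perm: "mset ds = mset (decimal_digits n)"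
  have "set ds = set (decimal_digits n)"
    using perm by (rule mset_eq_setD)
  then have "digit_sum (nat_of_digits ds) = sum_list ds"
    by (simp add: digit_sum_nat_of_digits decimal_digits_less_10)
  also have "\<dots> = digit_sum n"
    unfolding digit_sum_def using perm by (metis sum_mset_sum_list)
  finally have "digit_sum (nat_of_digits ds) = 1"
    using assms by simp
  then show "niven (nat_of_digits ds)"
    unfolding niven_def by (cases "nat_of_digits ds = 0") simp_all
qed

lemma digit_sum_power_10: "digit_sum (10 ^ k) = 1"
proof (induction k)
  case 0
  show ?case by (subst digit_sum_rec) simp
next
  case (Suc k)
  then show ?case by (subst digit_sum_rec) simp
qed

theorem mainTheorem2:
  shows "infinite {n. pinn n} \<and> (\<forall>N. \<exists>n. pinn n \<and> n > N)"
proof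
  show unbounded: "\<forall>N. \<exists>n. pinn n \<and> n > N"
  proof
    fix N :: nat
    have "pinn (10 ^ N)"
      by (intro pinn_if_digit_sum_1 digit_sum_power_10)
    moreover have "10 ^ N > N"
      by (rule power_gt_expt) simp
    ultimately show "\<exists>n. pinn n \<and> n > N" by blast
  qed
  then show "infinite {n. pinn n}"
    by (auto simp: finite_nat_set_iff_bounded_le not_le)
qed

end
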